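(* Let $n\ge 1$. (1) Any $f(\xi,z)\in\mathbb{C}[\xi,z]$ can be written uniquely as a sum of the form $$f(\xi,z)=\sum_{\alpha\in\mathbb{N}^n}\frac1{\alpha!}\Theta^\alpha a_\alpha(z)=\sum_{\alpha\in\mathbb{N}^n}\frac1{\alpha!}(\xi-\partial)^\alpha a_\alpha(z)$$ for some $a_\alpha(z)\in\mathbb{C}[z]$ ($\alpha\in\mathbb{N}^n$). (2) With this notation, for any $\alpha=(\alpha_1,\dots,\alpha_n)\in\mathbb{N}^n$, $$a_\alpha(z)=\mathcal{E}(\partial_\xi^\alpha f),\qquad\text{where }\partial_\xi^\alpha=\prod_{i=1}^n\partial_{\xi_i}^{\alpha_i}.$$ In particular, $a_0(z)=\mathcal{E}(f)$.
   Context: Here $z=(z_1,\dots,z_n)$ and $\xi=(\xi_1,\dots,\xi_n)$ are commuting free variables, $\partial_i:=\partial/\partial z_i$, $\partial=(\partial_1,\dots,\partial_n)$, $\partial_{\xi_i}:=\partial/\partial\xi_i$, and $\mathbb{N}$ includes $0$. The sums are finite, i.e. only finitely many $a_\alpha$ are nonzero. Put $\Theta_i:=\xi_i-\partial_i$, a differential operator of $\mathbb{C}[\xi,z]$; the $\Theta_i$ commute with one another, and for $\alpha\in\mathbb{N}^n$, $\Theta^\alpha=(\xi-\partial)^\alpha:=\Theta_1^{\alpha_1}\cdots\Theta_n^{\alpha_n}$ and $\alpha!:=\alpha_1!\cdots\alpha_n!$. The $\mathbb{C}$-linear map $\mathcal{E}:\mathbb{C}[\xi,z]\to\mathbb{C}[z]$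 is defined by $\mathcal{E}(g(\xi)h(z)):=g(\partial)h(z)$ for all $g(\xi)\in\mathbb{C}[\xi]$, $h(z)\in\mathbb{C}[z]$, where $g(\partial)$ is obtained by replacing each $\xi_i$ with $\partial_i$. *)

theory Defs
  imports Complex_Main "HOL-Library.Poly_Mapping"
begin

text \<open>
  Polynomials over the complex numbers in commuting indeterminates indexed by a type \<open>'v\<close>:
  finitely supported maps from exponents to coefficients, with the convolution product of
  \<open>Poly_Mapping\<close>. For a finite type \<open>'n\<close> with \<open>n\<close> elements, \<open>'n cpoly\<close> is \<open>\<complex>[z]\<close>, and
  \<open>('n + 'n) cpoly\<close> is \<open>\<complex>[\<xi>,z]\<close>, where \<open>Inl i\<close> is the index of \<open>\<xi>\<^sub>i\<close> and \<open>Inr i\<close> that of \<open>z\<^sub>i\<close>.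
\<close>

type_synonym 'v expo = "'v \<Rightarrow>\<^sub>0 nat"
type_synonym 'v cpoly = "'v expo \<Rightarrow>\<^sub>0 complex"

definition Const :: "complex \<Rightarrow> 'v cpoly"
  where "Const c = Poly_Mapping.single 0 c"

definition Monom :: "'v expo \<Rightarrow> 'v cpoly"
  where "Monom m = Poly_Mapping.single m 1"

definition Var :: "'v \<Rightarrow> 'v cpoly"
  where "Var v = Monom (Poly_Mapping.single v 1)"

text \<open>The \<open>\<complex>\<close>-linear map with prescribed values \<open>\<phi> m\<close> on the monomials with exponent \<open>m\<close>.\<close>

definition lin_ext :: "('v expo \<Rightarrow> 'w cpoly) \<Rightarrow> 'v cpoly \<Rightarrow> 'w cpoly"
  where "lin_ext \<phi> p = (\<Sum>m\<in>Poly_Mapping.keys p. Const (Poly_Mapping.lookup p m) * \<phi> m)"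

text \<open>
  Partial derivative. The truncated subtraction on exponents is harmless: the coefficient
  vanishes if the variable does not occur.
\<close>

definition mpderiv :: "'v \<Rightarrow> 'v cpoly \<Rightarrow> 'v cpoly"
  where "mpderiv v = lin_ext (\<lambda>m. Const (of_nat (Poly_Mapping.lookup m v)) *
                                   Monom (m - Poly_Mapping.single v 1))"

definition rename_expo :: "('v \<Rightarrow> 'w) \<Rightarrow> 'v expo \<Rightarrow> 'w expo"
  where "rename_expo \<phi> m = (\<Sum>v\<in>Poly_Mapping.keys m. Poly_Mapping.single (\<phi> v) (Poly_Mapping.lookup m v))"

text \<open>The polynomials \<open>g(\<xi>)\<close> and \<open>h(z)\<close> as elements of \<open>\<complex>[\<xi>,z]\<close>.\<close>

definition in_xi :: "'n cpoly \<Rightarrow> ('n + 'n) cpoly"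
  where "in_xi = lin_ext (\<lambda>m. Monom (rename_expo Inl m))"

definition in_z :: "'n cpoly \<Rightarrow> ('n + 'n) cpoly"
  where "in_z = lin_ext (\<lambda>m. Monom (rename_expo Inr m))"

text \<open>
  \<open>multi_pow D \<alpha>\<close> is \<open>D\<^sup>\<alpha>\<close>, the composite of the \<open>\<alpha>\<^sub>i\<close>-fold iterates of the \<open>D i\<close>. It is meant for
  families of pairwise commuting operators, for which the order of composition is irrelevant
  (see \<open>multi_pow_eq_foldr\<close> below).
\<close>

definition multi_pow :: "('n::finite \<Rightarrow> 'a \<Rightarrow> 'a) \<Rightarrow> 'n expo \<Rightarrow> 'a \<Rightarrow> 'a"
  where "multi_pow D \<alpha> x = Finite_Set.fold (\<lambda>i. D i ^^ Poly_Mapping.lookup \<alpha> i) x UNIV"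

definition multi_fact :: "'n::finite expo \<Rightarrow> complex"
  where "multi_fact \<alpha> = (\<Prod>i\<in>UNIV. fact (Poly_Mapping.lookup \<alpha> i))"

definition Theta :: "'n \<Rightarrow> ('n + 'n) cpoly \<Rightarrow> ('n + 'n) cpoly"
  where "Theta i f = Var (Inl i) * f - mpderiv (Inr i) f"

definition mpderiv_xi :: "'n \<Rightarrow> ('n + 'n) cpoly \<Rightarrow> ('n + 'n) cpoly"
  where "mpderiv_xi i = mpderiv (Inl i)"

text \<open>\<open>diff_op g h\<close> is \<open>g(\<partial>) h\<close>.\<close>

definition diff_op :: "'n::finite cpoly \<Rightarrow> 'n cpoly \<Rightarrow> 'n cpoly"
  where "diff_op g h = lin_ext (\<lambda>\<alpha>. multi_pow mpderiv \<alpha> h) g"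

text \<open>
  The map \<open>\<E>\<close>, defined by its values \<open>\<partial>\<^sup>\<alpha> z\<^sup>\<beta>\<close> on the monomials \<open>\<xi>\<^sup>\<alpha> z\<^sup>\<beta>\<close>. That this is the
  linear map with \<open>\<E> (g(\<xi>) h(z)) = g(\<partial>) h(z)\<close> for all \<open>g\<close> and \<open>h\<close> is shown in \<open>calE_add\<close>,
  \<open>calE_Const_mult\<close> and \<open>calE_in_xi_in_z\<close> below.
\<close>

definition calE :: "('n::finite + 'n) cpoly \<Rightarrow> 'n cpoly"
  where "calE = lin_ext (\<lambda>m. multi_pow mpderiv (Poly_Mapping.map_key Inl m)
                                (Monom (Poly_Mapping.map_key Inr m)))"


subsection \<open>The iterated composition is well defined\<close>

lemma funpow_commute_funpow:
  assumes "\<And>x. f (g x) = g (f x)"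
  shows "(f ^^ a) ((g ^^ b) x) = (g ^^ b) ((f ^^ a) x)"
proof -
  have *: "f ((g ^^ b) x) = (g ^^ b) (f x)" for x b
    by (induction b) (simp_all add: assms)
  show ?thesis
    by (induction a) (simp_all add: *)
qed

lemma multi_pow_eq_foldr:
  assumes "\<And>i j x. D i (D j x) = D j (D i x)" and "distinct ns" and "set ns = UNIV"
  shows "multi_pow D \<alpha> x = foldr (\<lambda>i. D i ^^ Poly_Mapping.lookup \<alpha> i) ns x"
proof -
  interpret comp_fun_commute "\<lambda>i. D i ^^ Poly_Mapping.lookup \<alpha> i"
    by standard (auto simp: fun_eq_iff intro!: funpow_commute_funpow assms(1))
  have "Finite_Set.fold (\<lambda>i. D i ^^ Poly_Mapping.lookup \<alpha> i) x (set js) =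
      foldr (\<lambda>i. D i ^^ Poly_Mapping.lookup \<alpha> i) js x" if "distinct js" for js
    using that by (induction js) simp_all
  then show ?thesis
    using assms(2,3) unfolding multi_pow_def by metis
qed


subsection \<open>Linear maps\<close>

lemma Const_0 [simp]: "Const 0 = 0"
  by (simp add: Const_def)

lemma Const_1 [simp]: "Const 1 = 1"
  by (simp add: Const_def)

lemma Const_add: "Const (a + b) = Const a + Const b"
  by (simp add: Const_def single_add)

lemma Const_mult: "Const (a * b) = Const a * Const b"
  by (simp add: Const_def mult_single)

lemma Const_Monom: "Const c * Monom m = Poly_Mapping.single m c"
  by (simp add: Const_def Monom_def mult_single)

lemma Monom_mult: "Monom m * Monom m' = Monom (m + m')"
  by (simp add: Monom_def mult_single)

lemma lin_ext_0 [simp]: "lin_ext \<phi> 0 = 0"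
  by (simp add: lin_ext_def)

lemma lin_ext_add: "lin_ext \<phi> (p + q) = lin_ext \<phi> p + lin_ext \<phi> q"
  unfolding lin_ext_def
  by (rule setsum_keys_plus_distrib) (simp_all add: Const_add distrib_right)

lemma lin_ext_single: "lin_ext \<phi> (Poly_Mapping.single m c) = Const c * \<phi> m"
  by (simp add: lin_ext_def)

lemma lin_ext_Monom [simp]: "lin_ext \<phi> (Monom m) = \<phi> m"
  by (simp add: Monom_def lin_ext_single)

lemma cpoly_induct [case_names zero add]:
  assumes "P 0" and "\<And>m c p. P p \<Longrightarrow> P (Const c * Monom m + p)"
  shows "P (p :: 'v cpoly)"
proof (induction p rule: update_induct)
  case const
  show ?case by (rule assms(1))
next
  case (update p m c)
  have "Poly_Mapping.update m c p = Const c * Monom m + p"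
    using update(1)
    by (auto simp: Const_Monom lookup_update lookup_add lookup_single when_def in_keys_iff
             intro!: poly_mapping_eqI)
  then show ?case
    using assms(2)[OF update(3)] by simp
qed

lemma lin_ext_Const_mult: "lin_ext \<phi> (Const c * p) = Const c * lin_ext \<phi> p"
proof (induction p rule: cpoly_induct)
  case (add m d p)
  have "Const c * (Const d * Monom m + p) = Const (c * d) * Monom m + Const c * p"
    by (simp add: Const_mult algebra_simps)
  then have *: "lin_ext \<phi> (Const c * (Const d * Monom m + p)) =
      lin_ext \<phi> (Const (c * d) * Monom m) + Const c * lin_ext \<phi> p"
    by (simp only: lin_ext_add add.IH)
  show ?case
    unfolding *
    by (simp only: Const_Monom lin_ext_single lin_ext_add)
      (simp only: Const_mult distrib_left mult.assoc)
qed simp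

lemma lin_ext_uminus: "lin_ext \<phi> (- p) = - lin_ext \<phi> p"
  using lin_ext_add[of \<phi> p "- p"] by (simp add: eq_neg_iff_add_eq_0 add.commute)

lemma lin_ext_diff: "lin_ext \<phi> (p - q) = lin_ext \<phi> p - lin_ext \<phi> q"
  using lin_ext_add[of \<phi> p "- q"] by (simp add: lin_ext_uminus)


subsection \<open>Partial derivatives\<close>

lemma mpderiv_0 [simp]: "mpderiv v 0 = 0"
  by (simp add: mpderiv_def)

lemma mpderiv_add: "mpderiv v (p + q) = mpderiv v p + mpderiv v q"
  by (simp add: mpderiv_def lin_ext_add)

lemma mpderiv_diff: "mpderiv v (p - q) = mpderiv v p - mpderiv v q"
  by (simp add: mpderiv_def lin_ext_diff)

lemma mpderiv_Const_mult: "mpderiv v (Const c * p) = Const c * mpderiv v p"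
  by (simp add: mpderiv_def lin_ext_Const_mult)

lemma mpderiv_Monom:
  "mpderiv v (Monom m) = Const (of_nat (Poly_Mapping.lookup m v)) * Monom (m - Poly_Mapping.single v 1)"
  by (simp add: mpderiv_def)

lemma mpderiv_Var: "mpderiv v (Var w) = (if v = w then 1 else 0)"
  by (auto simp: Var_def mpderiv_Monom lookup_single) (simp add: Monom_def)

lemma expo_minus_add:
  assumes "Poly_Mapping.lookup m v \<noteq> (0 :: nat)"
  shows "m' + (m - Poly_Mapping.single v 1) = m' + m - Poly_Mapping.single v 1"
  using assms by (intro poly_mapping_eqI) (auto simp: lookup_add lookup_minus lookup_single when_def)

lemma mpderiv_mult: "mpderiv v (p * q) = mpderiv v p * q + p * mpderiv v q"
proof (induction p rule: cpoly_induct)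
  case (add m c p)
  have "mpderiv v (Monom m * q) = mpderiv v (Monom m) * q + Monom m * mpderiv v q"
  proof (induction q rule: cpoly_induct)
    case (add m' c' q)
    have 1: "Const (of_nat (Poly_Mapping.lookup m v)) * Monom (m - Poly_Mapping.single v 1) * Monom m' =
        Const (of_nat (Poly_Mapping.lookup m v)) * Monom (m + m' - Poly_Mapping.single v 1)"
      using expo_minus_add[of m v m']
      by (cases "Poly_Mapping.lookup m v = 0") (simp_all add: Monom_mult mult.assoc add.commute)
    have 2: "Monom m * (Const (of_nat (Poly_Mapping.lookup m' v)) * Monom (m' - Poly_Mapping.single v 1)) =
        Const (of_nat (Poly_Mapping.lookup m' v)) * Monom (m + m' - Poly_Mapping.single v 1)"
      using expo_minus_add[of m' v m]
      by (cases "Poly_Mapping.lookup m' v = 0") (simp_all add: Monom_mult mult.left_commute[of "Monom m"])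
    have "mpderiv v (Monom m * Monom m') = mpderiv v (Monom m) * Monom m' + Monom m * mpderiv v (Monom m')"
      unfolding mpderiv_Monom Monom_mult 1 2
      by (simp add: lookup_add Const_add distrib_right)
    moreover have "Monom m * (Const c' * Monom m' + q) = Const c' * (Monom m * Monom m') + Monom m * q"
      by (simp add: algebra_simps)
    ultimately have "mpderiv v (Monom m * (Const c' * Monom m' + q)) =
        Const c' * (mpderiv v (Monom m) * Monom m' + Monom m * mpderiv v (Monom m')) +
        (mpderiv v (Monom m) * q + Monom m * mpderiv v q)"
      by (simp only: mpderiv_add mpderiv_Const_mult add.IH)
    then show ?case
      by (simp only: mpderiv_add mpderiv_Const_mult) (simp only: algebra_simps)
  qed simp
  moreover have "(Const c * Monom m + p) * q = Const c * (Monom m * q) + p * q"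
    by (simp add: algebra_simps)
  ultimately have "mpderiv v ((Const c * Monom m + p) * q) =
      Const c * (mpderiv v (Monom m) * q + Monom m * mpderiv v q) + (mpderiv v p * q + p * mpderiv v q)"
    by (simp only: mpderiv_add mpderiv_Const_mult add.IH)
  then show ?case
    by (simp only: mpderiv_add mpderiv_Const_mult) (simp only: algebra_simps)
qed simp

lemma mpderiv_commute: "mpderiv v (mpderiv w p) = mpderiv w (mpderiv v p)"
proof (induction p rule: cpoly_induct)
  case (add m c p)
  have "mpderiv v (mpderiv w (Monom m)) = mpderiv w (mpderiv v (Monom m))"
    by (cases "v = w")
      (simp_all add: mpderiv_Monom mpderiv_Const_mult lookup_minus lookup_single
        diff_diff_add add.commute mult.left_commute)
  then show ?case
    by (simp add: mpderiv_add mpderiv_Const_mult add.IH)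
qed simp

lemma Theta_commute: "Theta i (Theta j f) = Theta j (Theta i f)"
  by (simp add: Theta_def mpderiv_diff mpderiv_mult mpderiv_Var mpderiv_commute[of "Inr i" "Inr j"]
      algebra_simps)

lemma mpderiv_xi_commute: "mpderiv_xi i (mpderiv_xi j f) = mpderiv_xi j (mpderiv_xi i f)"
  by (simp add: mpderiv_xi_def mpderiv_commute)


subsection \<open>The characterization of \<open>\<E>\<close>\<close>

lemma multi_pow_linear:
  assumes "\<And>i j x. D i (D j x) = D j (D i x)"
    and "\<And>i x y. D i (x + y) = D i x + D i y" and "\<And>i c x. D i (Const c * x) = Const c * D i x"
  shows "multi_pow D \<alpha> (x + y) = multi_pow D \<alpha> x + multi_pow D \<alpha> y"
    and "multi_pow D \<alpha> (Const c * x) = Const c * multi_pow D \<alpha> x"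
proof -
  obtain ns :: "'a list" where ns: "distinct ns" "set ns = UNIV"
    using finite_distinct_list[OF finite_UNIV] by blast
  note eq = multi_pow_eq_foldr[where D = D, OF assms(1) ns]
  have p: "(D i ^^ k) (x + y) = (D i ^^ k) x + (D i ^^ k) y"
    "(D i ^^ k) (Const c * x) = Const c * (D i ^^ k) x" for i k x y
    by (induction k) (simp_all add: assms(2,3))
  have "foldr (\<lambda>i. D i ^^ Poly_Mapping.lookup \<alpha> i) js (x + y) =
      foldr (\<lambda>i. D i ^^ Poly_Mapping.lookup \<alpha> i) js x + foldr (\<lambda>i. D i ^^ Poly_Mapping.lookup \<alpha> i) js y"
    "foldr (\<lambda>i. D i ^^ Poly_Mapping.lookup \<alpha> i) js (Const c * x) =
      Const c * foldr (\<lambda>i. D i ^^ Poly_Mapping.lookup \<alpha> i) js x" for js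
    by (induction js) (simp_all add: p)
  then show "multi_pow D \<alpha> (x + y) = multi_pow D \<alpha> x + multi_pow D \<alpha> y"
    and "multi_pow D \<alpha> (Const c * x) = Const c * multi_pow D \<alpha> x"
    by (simp_all add: eq)
qed

lemmas multi_pow_mpderiv_linear =
  multi_pow_linear[where D = mpderiv, OF mpderiv_commute mpderiv_add mpderiv_Const_mult]

lemma lookup_rename_expo:
  "Poly_Mapping.lookup (rename_expo \<phi> m) w =
    (\<Sum>v\<in>Poly_Mapping.keys m. Poly_Mapping.lookup m v when \<phi> v = w)"
  by (simp add: rename_expo_def lookup_sum lookup_single)

lemma lookup_rename_expo_inj:
  assumes "inj \<phi>"
  shows "Poly_Mapping.lookup (rename_expo \<phi> m) (\<phi> v) = Poly_Mapping.lookup m v"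
  using assms by (auto simp: lookup_rename_expo inj_eq when_def sum.delta' in_keys_iff)

lemma lookup_rename_expo_notin:
  assumes "\<And>v. \<phi> v \<noteq> w"
  shows "Poly_Mapping.lookup (rename_expo \<phi> m) w = 0"
  using assms by (simp add: lookup_rename_expo)

lemma map_key_rename_expo:
  "Poly_Mapping.map_key Inl (rename_expo Inl \<alpha> + rename_expo Inr \<beta>) = \<alpha>"
  "Poly_Mapping.map_key Inr (rename_expo Inl \<alpha> + rename_expo Inr \<beta>) = \<beta>"
  by (auto intro!: poly_mapping_eqI simp: map_key.rep_eq lookup_add lookup_rename_expo_inj
      lookup_rename_expo_notin)

lemma calE_add: "calE (f + g) = calE f + calE g"
  by (simp add: calE_def lin_ext_add)

lemma calE_Const_mult: "calE (Const c * f) = Const c * calE f"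
  by (simp add: calE_def lin_ext_Const_mult)

lemma calE_in_xi_in_z: "calE (in_xi g * in_z h) = diff_op g h"
proof (induction g rule: cpoly_induct)
  case zero
  show ?case by (simp add: calE_def in_xi_def diff_op_def)
next
  case (add \<alpha> c g)
  have "calE (Monom (rename_expo Inl \<alpha>) * in_z h) = multi_pow mpderiv \<alpha> h"
  proof (induction h rule: cpoly_induct)
    case zero
    have "multi_pow mpderiv \<alpha> (Const 0 * 0) = 0"
      unfolding multi_pow_mpderiv_linear(2) by simp
    then show ?case by (simp add: calE_def in_z_def)
  next
    case (add \<beta> d h)
    have "in_z (Const d * Monom \<beta> + h) = Const d * Monom (rename_expo Inr \<beta>) + in_z h"
      by (simp add: in_z_def lin_ext_add lin_ext_Const_mult)
    then have "Monom (rename_expo Inl \<alpha>) * in_z (Const d * Monom \<beta> + h) =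
      Const d * Monom (rename_expo Inl \<alpha> + rename_expo Inr \<beta>) + Monom (rename_expo Inl \<alpha>) * in_z h"
      by (simp add: algebra_simps flip: Monom_mult)
    then have "calE (Monom (rename_expo Inl \<alpha>) * in_z (Const d * Monom \<beta> + h)) =
      Const d * calE (Monom (rename_expo Inl \<alpha> + rename_expo Inr \<beta>)) + multi_pow mpderiv \<alpha> h"
      by (simp only: calE_add calE_Const_mult add.IH)
    also have "calE (Monom (rename_expo Inl \<alpha> + rename_expo Inr \<beta>)) = multi_pow mpderiv \<alpha> (Monom \<beta>)"
      by (simp add: calE_def map_key_rename_expo)
    finally show ?case
      by (simp only: multi_pow_mpderiv_linear)
  qed
  moreover have "in_xi (Const c * Monom \<alpha> + g) * in_z h =
      Const c * (Monom (rename_expo Inl \<alpha>) * in_z h) + in_xi g * in_z h"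
    by (simp add: in_xi_def lin_ext_add lin_ext_Const_mult algebra_simps)
  ultimately show ?case
    by (simp add: calE_add calE_Const_mult add.IH)
      (simp add: diff_op_def lin_ext_add lin_ext_Const_mult)
qed

end

theory Submission
  imports Defs
begin

text \<open>
  Write \<open>T \<alpha> b = \<Theta>\<^sup>\<alpha> b(z) / \<alpha>!\<close>, and \<open>e\<^sub>i\<close> for the \<open>i\<close>-th unit exponent. Three observations give the theorem.

  \<^item> The operators satisfy \<open>[\<partial>\<^bsub>\<xi>\<^sub>i\<^esub>, \<Theta>\<^sub>j] = \<delta>\<^sub>i\<^sub>j\<close>, and \<open>\<partial>\<^bsub>\<xi>\<^sub>i\<^esub>\<close> kills \<open>\<complex>[z]\<close>, so that \<open>\<partial>\<^bsub>\<xi>\<^sub>i\<^esub>\<close> sends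
    \<open>T \<alpha> b\<close> to \<open>T (\<alpha> - e\<^sub>i) b\<close>, or to \<open>0\<close> if \<open>\<alpha>\<^sub>i = 0\<close>: the \<open>T \<alpha> b\<close> behave under \<open>\<partial>\<^sub>\<xi>\<close> like
    \<open>\<xi>\<^sup>\<alpha> b / \<alpha>!\<close> (\<open>mpderiv_xi_Theta_term\<close>).
  \<^item> The map \<open>\<E>\<close> turns multiplication by \<open>\<xi>\<^sub>i\<close> as well as \<open>\<partial>\<^bsub>z\<^sub>i\<^esub>\<close> into \<open>\<partial>\<^sub>i\<close>, so that \<open>\<E> \<circ> \<Theta>\<^sub>i = 0\<close>;
    moreover \<open>\<E>\<close> is the identity on \<open>\<complex>[z]\<close>. Thus \<open>\<E> (T \<alpha> b)\<close> is \<open>b\<close> for \<open>\<alpha> = 0\<close> and \<open>0\<close> otherwise.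
    Together with the first point, \<open>\<E> (\<partial>\<^sub>\<xi>\<^sup>\<beta> (T \<alpha> b))\<close> is \<open>b\<close> for \<open>\<alpha> = \<beta>\<close> and \<open>0\<close> otherwise
    (\<open>calE_mpderiv_xi_Theta_term\<close>). This yields the coefficient formula, and hence uniqueness.
  \<^item> The sums of elements \<open>\<Theta>\<^sup>\<alpha> b(z)\<close> contain \<open>\<complex>[z]\<close> and are stable under \<open>\<Theta>\<^sub>i\<close> and under \<open>\<partial>\<^bsub>z\<^sub>i\<^esub>\<close>,
    which commutes with all \<open>\<Theta>\<^sub>j\<close>. Hence they are stable under multiplication by
    \<open>\<xi>\<^sub>i = \<Theta>\<^sub>i + \<partial>\<^bsub>z\<^sub>i\<^esub>\<close>, and so they exhaust \<open>\<complex>[\<xi>,z]\<close> (\<open>Theta_span_all\<close>). This is existence.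
\<close>


section \<open>Exponents and iterated operators\<close>

lemma expo_induct [case_names zero add]:
  assumes "P 0" and step: "\<And>\<alpha> i. P \<alpha> \<Longrightarrow> P (\<alpha> + Poly_Mapping.single i 1)"
  shows "P (\<alpha> :: 'v expo)"
proof (induction \<alpha> rule: update_induct)
  case const
  show ?case by (rule assms(1))
next
  case (update p i n)
  have "P (p + Poly_Mapping.single i n)" for n
  proof (induction n)
    case 0
    show ?case using update by simp
  next
    case (Suc n)
    have "p + Poly_Mapping.single i (Suc n) = p + Poly_Mapping.single i n + Poly_Mapping.single i 1"
      by (simp add: add.assoc flip: single_add)
    then show ?case using step[OF Suc] by simp
  qed
  moreover have "Poly_Mapping.update i n p = p + Poly_Mapping.single i n"
    using update(1)
    by (auto simp: lookup_update lookup_add lookup_single when_def in_keys_iff intro!: poly_mapping_eqI)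
  ultimately show ?case by simp
qed

lemma minus_single_add_single:
  assumes "Poly_Mapping.lookup \<alpha> i \<noteq> (0 :: nat)"
  shows "\<alpha> - Poly_Mapping.single i 1 + Poly_Mapping.single i 1 = \<alpha>"
  using assms by (intro poly_mapping_eqI) (auto simp: lookup_add lookup_minus lookup_single when_def)

lemma expo_nonzeroE:
  assumes "\<alpha> \<noteq> (0 :: 'v expo)"
  obtains \<gamma> i where "\<alpha> = \<gamma> + Poly_Mapping.single i 1"
proof -
  obtain i where "Poly_Mapping.lookup \<alpha> i \<noteq> 0"
    using assms by (metis lookup_zero poly_mapping_eqI)
  from minus_single_add_single[OF this] show thesis
    using that by metis
qed

lemma multi_pow_0 [simp]:
  fixes D :: "'n::finite \<Rightarrow> 'a \<Rightarrow> 'a"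
  shows "multi_pow D 0 x = x"
proof -
  interpret comp_fun_commute "\<lambda>(i :: 'n) (x :: 'a). x"
    by standard auto
  have "Finite_Set.fold (\<lambda>i x. x) x A = x" if "finite A" for A :: "'n set"
    using that by induction auto
  then show ?thesis
    by (simp add: multi_pow_def id_def)
qed

text \<open>
  For commuting operators, \<open>D\<^sup>\<alpha>\<^sup>+\<^sup>e = D\<^sub>i \<circ> D\<^sup>\<alpha>\<close> with \<open>e\<close> the \<open>i\<close>-th unit exponent. This recursion replaces
  the definition by iterated composition in all that follows.
\<close>

lemma multi_pow_add_single:
  assumes comm: "\<And>i j x. D i (D j x) = D j (D i x)"
  shows "multi_pow D (\<alpha> + Poly_Mapping.single i 1) x = D i (multi_pow D \<alpha> x)"
proof -
  obtain js where js: "distinct js" "set js = UNIV - {i}"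
    using finite_distinct_list[of "UNIV - {i}"] by auto
  have foldr: "multi_pow D \<beta> x = foldr (\<lambda>j. D j ^^ Poly_Mapping.lookup \<beta> j) (i # js) x" for \<beta>
    using js by (intro multi_pow_eq_foldr comm) auto
  have "foldr (\<lambda>j. D j ^^ Poly_Mapping.lookup (\<alpha> + Poly_Mapping.single i 1) j) js x =
      foldr (\<lambda>j. D j ^^ Poly_Mapping.lookup \<alpha> j) js x"
    using js by (intro foldr_cong) (auto simp: lookup_add lookup_single when_def)
  then show ?thesis
    unfolding foldr by (simp add: lookup_add)
qed

lemma multi_pow_commute:
  assumes comm: "\<And>i j x. D i (D j x) = D j (D i x)" and F: "\<And>i x. F (D i x) = D i (F x)"
  shows "F (multi_pow D \<alpha> x) = multi_pow D \<alpha> (F x)"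
proof (induction \<alpha> rule: expo_induct)
  case (add \<alpha> i)
  then show ?case
    by (simp add: multi_pow_add_single[where D = D, OF comm, simplified] F)
qed simp

lemma multi_pow_add_single_right:
  assumes comm: "\<And>i j x. D i (D j x) = D j (D i x)"
  shows "multi_pow D (\<alpha> + Poly_Mapping.single i 1) x = multi_pow D \<alpha> (D i x)"
  using multi_pow_add_single[where D = D, OF comm] multi_pow_commute[where D = D and F = "D i", OF comm comm]
  by metis

lemmas multi_pow_mpderiv_add = multi_pow_add_single[where D = mpderiv, OF mpderiv_commute]
lemmas multi_pow_Theta_add = multi_pow_add_single[where D = Theta, OF Theta_commute]
lemmas multi_pow_xi_add = multi_pow_add_single_right[where D = mpderiv_xi, OF mpderiv_xi_commute]

lemma multi_fact_add_single:
  "multi_fact (\<alpha> + Poly_Mapping.single i 1) = of_nat (Poly_Mapping.lookup \<alpha> i + 1) * multi_fact \<alpha>"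
proof -
  have split: "multi_fact \<beta> = fact (Poly_Mapping.lookup \<beta> i) * (\<Prod>j\<in>UNIV - {i}. fact (Poly_Mapping.lookup \<beta> j))" for \<beta>
    unfolding multi_fact_def by (rule prod.remove) auto
  have "(\<Prod>j\<in>UNIV - {i}. fact (Poly_Mapping.lookup (\<alpha> + Poly_Mapping.single i 1) j) :: complex) =
      (\<Prod>j\<in>UNIV - {i}. fact (Poly_Mapping.lookup \<alpha> j))"
    by (rule prod.cong) (auto simp: lookup_add lookup_single)
  then show ?thesis
    unfolding split by (simp add: lookup_add algebra_simps)
qed

lemma multi_fact_nonzero [simp]: "multi_fact \<alpha> \<noteq> 0"
  by (simp add: multi_fact_def)


section \<open>Linearity, polynomials in z, and commutation relations\<close>

lemma in_z_add: "in_z (p + q) = in_z p + in_z q"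
  by (simp add: in_z_def lin_ext_add)

lemma in_z_Const_mult: "in_z (Const c * p) = Const c * in_z p"
  by (simp add: in_z_def lin_ext_Const_mult)

lemma in_z_Monom: "in_z (Monom \<beta>) = Monom (rename_expo Inr \<beta>)"
  by (simp add: in_z_def)

lemma mpderiv_xi_in_z [simp]: "mpderiv_xi i (in_z p) = 0"
proof (induction p rule: cpoly_induct)
  case zero
  show ?case by (simp add: in_z_def mpderiv_xi_def)
next
  case (add \<beta> c p)
  then show ?case
    by (simp add: in_z_add in_z_Const_mult in_z_Monom mpderiv_xi_def mpderiv_add mpderiv_Const_mult
        mpderiv_Monom lookup_rename_expo_notin)
qed

lemma rename_expo_minus_single:
  assumes "inj \<phi>"
  shows "rename_expo \<phi> (\<beta> - Poly_Mapping.single i 1) = rename_expo \<phi> \<beta> - Poly_Mapping.single (\<phi> i) 1"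
proof (rule poly_mapping_eqI)
  fix w
  show "Poly_Mapping.lookup (rename_expo \<phi> (\<beta> - Poly_Mapping.single i 1)) w =
      Poly_Mapping.lookup (rename_expo \<phi> \<beta> - Poly_Mapping.single (\<phi> i) 1) w"
  proof (cases "w \<in> range \<phi>")
    case True
    with assms show ?thesis
      by (auto simp: lookup_rename_expo_inj lookup_minus lookup_single when_def inj_eq)
  next
    case False
    then have "\<phi> v \<noteq> w" for v by auto
    then show ?thesis
      by (simp add: lookup_minus lookup_rename_expo_notin)
  qed
qed

lemma rename_expo_add_single:
  assumes "inj \<phi>"
  shows "rename_expo \<phi> (\<beta> + Poly_Mapping.single i 1) = rename_expo \<phi> \<beta> + Poly_Mapping.single (\<phi> i) 1"
proof (rule poly_mapping_eqI)
  fix w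
  show "Poly_Mapping.lookup (rename_expo \<phi> (\<beta> + Poly_Mapping.single i 1)) w =
      Poly_Mapping.lookup (rename_expo \<phi> \<beta> + Poly_Mapping.single (\<phi> i) 1) w"
  proof (cases "w \<in> range \<phi>")
    case True
    with assms show ?thesis
      by (auto simp: lookup_rename_expo_inj lookup_add lookup_single when_def inj_eq)
  next
    case False
    then have "\<phi> v \<noteq> w" for v by auto
    then show ?thesis
      by (simp add: lookup_add lookup_single lookup_rename_expo_notin)
  qed
qed

lemma mpderiv_Inr_in_z: "mpderiv (Inr i) (in_z p) = in_z (mpderiv i p)"
proof (induction p rule: cpoly_induct)
  case zero
  show ?case by (simp add: in_z_def)
next
  case (add \<beta> c p)
  then show ?case
    by (simp add: in_z_add in_z_Const_mult in_z_Monom mpderiv_add mpderiv_Const_mult mpderiv_Monom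
        lookup_rename_expo_inj rename_expo_minus_single[simplified])
qed

lemma Theta_add: "Theta i (f + g) = Theta i f + Theta i g"
  by (simp add: Theta_def mpderiv_add algebra_simps)

lemma Theta_0 [simp]: "Theta i 0 = 0"
  by (simp add: Theta_def)

lemma Theta_Const_mult: "Theta i (Const c * f) = Const c * Theta i f"
  by (simp add: Theta_def mpderiv_Const_mult right_diff_distrib mult.left_commute)

lemmas multi_pow_Theta_linear =
  multi_pow_linear[where D = Theta, OF Theta_commute Theta_add Theta_Const_mult]

lemma mpderiv_xi_0 [simp]: "mpderiv_xi i 0 = 0"
  by (simp add: mpderiv_xi_def)

lemma mpderiv_xi_add: "mpderiv_xi i (f + g) = mpderiv_xi i f + mpderiv_xi i g"
  by (simp add: mpderiv_xi_def mpderiv_add)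

lemma mpderiv_xi_Const_mult: "mpderiv_xi i (Const c * f) = Const c * mpderiv_xi i f"
  by (simp add: mpderiv_xi_def mpderiv_Const_mult)

lemmas multi_pow_xi_linear =
  multi_pow_linear[where D = mpderiv_xi, OF mpderiv_xi_commute mpderiv_xi_add mpderiv_xi_Const_mult]

lemma mpderiv_Inr_Theta: "mpderiv (Inr i) (Theta j f) = Theta j (mpderiv (Inr i) f)"
  by (simp add: Theta_def mpderiv_diff mpderiv_mult mpderiv_Var mpderiv_commute[of "Inr i" "Inr j"])

lemma mpderiv_xi_Theta:
  "mpderiv_xi i (Theta j f) = Theta j (mpderiv_xi i f) + (if i = j then f else 0)"
  by (simp add: Theta_def mpderiv_xi_def mpderiv_diff mpderiv_mult mpderiv_Var
      mpderiv_commute[of "Inl i" "Inr j"])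


section \<open>The map \<open>\<E>\<close> annihilates the image of the operators \<open>\<Theta>\<close>\<close>

lemma calE_0 [simp]: "calE 0 = 0"
  by (simp add: calE_def)

lemma calE_diff: "calE (f - g) = calE f - calE g"
  by (simp add: calE_def lin_ext_diff)

lemma calE_Monom:
  "calE (Monom m) = multi_pow mpderiv (Poly_Mapping.map_key Inl m) (Monom (Poly_Mapping.map_key Inr m))"
  by (simp add: calE_def)

lemma calE_in_z [simp]: "calE (in_z h) = h"
proof -
  have "in_xi (Monom (0 :: 'a expo)) = 1"
    unfolding in_xi_def lin_ext_Monom by (simp add: rename_expo_def Monom_def)
  moreover have "diff_op (Monom 0) h = h"
    by (simp add: diff_op_def)
  ultimately show ?thesis
    using calE_in_xi_in_z[of "Monom 0" h] by (metis mult_1_left)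
qed

lemma calE_xi_mult: "calE (Var (Inl i) * f) = mpderiv i (calE f)"
proof (induction f rule: cpoly_induct)
  case (add m c f)
  have keys: "Poly_Mapping.map_key Inl (Poly_Mapping.single (Inl i) 1 + m) =
        Poly_Mapping.map_key Inl m + Poly_Mapping.single i 1"
      "Poly_Mapping.map_key Inr (Poly_Mapping.single (Inl i) 1 + m) = Poly_Mapping.map_key Inr m"
    by (auto intro!: poly_mapping_eqI simp: map_key.rep_eq lookup_add lookup_single when_def)
  have "calE (Var (Inl i) * Monom m) = mpderiv i (calE (Monom m))"
    unfolding Var_def Monom_mult calE_Monom keys multi_pow_mpderiv_add ..
  moreover have "Var (Inl i) * (Const c * Monom m + f) =
      Const c * (Var (Inl i) * Monom m) + Var (Inl i) * f"
    by (simp add: algebra_simps)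
  ultimately show ?case
    using add by (simp only: calE_add calE_Const_mult mpderiv_add mpderiv_Const_mult)
qed simp

lemma calE_mpderiv_Inr: "calE (mpderiv (Inr i) f) = mpderiv i (calE f)"
proof (induction f rule: cpoly_induct)
  case (add m c f)
  have keys: "Poly_Mapping.map_key Inl (m - Poly_Mapping.single (Inr i) 1) = Poly_Mapping.map_key Inl m"
      "Poly_Mapping.map_key Inr (m - Poly_Mapping.single (Inr i) 1) =
        Poly_Mapping.map_key Inr m - Poly_Mapping.single i 1"
    by (auto intro!: poly_mapping_eqI simp: map_key.rep_eq lookup_minus lookup_single when_def)
  have "calE (mpderiv (Inr i) (Monom m)) =
      multi_pow mpderiv (Poly_Mapping.map_key Inl m) (mpderiv i (Monom (Poly_Mapping.map_key Inr m)))"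
    unfolding mpderiv_Monom calE_Const_mult calE_Monom keys multi_pow_mpderiv_linear(2)
    by (simp add: map_key.rep_eq)
  also have "\<dots> = mpderiv i (calE (Monom m))"
    unfolding calE_Monom
    by (rule multi_pow_commute[where D = mpderiv, symmetric]) (rule mpderiv_commute)+
  finally show ?case
    using add by (simp only: calE_add calE_Const_mult mpderiv_add mpderiv_Const_mult)
qed simp

lemma calE_Theta [simp]: "calE (Theta i f) = 0"
  by (simp add: Theta_def calE_diff calE_xi_mult calE_mpderiv_Inr)


section \<open>Extraction of coefficients\<close>

text \<open>The summand \<open>\<Theta>\<^sup>\<alpha> b(z) / \<alpha>!\<close>.\<close>

definition Theta_term :: "'n::finite expo \<Rightarrow> 'n cpoly \<Rightarrow> ('n + 'n) cpoly"
  where "Theta_term \<alpha> b = Const (1 / multi_fact \<alpha>) * multi_pow Theta \<alpha> (in_z b)"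

lemma Theta_term_add: "Theta_term \<alpha> (b + c) = Theta_term \<alpha> b + Theta_term \<alpha> c"
  by (simp add: Theta_term_def in_z_add multi_pow_Theta_linear algebra_simps)

lemma Theta_term_0 [simp]: "Theta_term \<alpha> 0 = 0"
  using Theta_term_add[of \<alpha> 0 0] by simp

lemma multi_pow_Theta_eq_term:
  "multi_pow Theta \<alpha> (in_z b) = Theta_term \<alpha> (Const (multi_fact \<alpha>) * b)"
proof -
  have "Theta_term \<alpha> (Const (multi_fact \<alpha>) * b) =
      Const (1 / multi_fact \<alpha> * multi_fact \<alpha>) * multi_pow Theta \<alpha> (in_z b)"
    unfolding Theta_term_def in_z_Const_mult multi_pow_Theta_linear(2) Const_mult by (simp add: mult.assoc)
  then show ?thesis by simp
qed

lemma mpderiv_xi_multi_pow_Theta: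
  "mpderiv_xi i (multi_pow Theta \<alpha> (in_z b)) =
    Const (of_nat (Poly_Mapping.lookup \<alpha> i)) * multi_pow Theta (\<alpha> - Poly_Mapping.single i 1) (in_z b)"
proof (induction \<alpha> rule: expo_induct)
  case zero
  show ?case by simp
next
  case (add \<alpha> j)
  let ?P = "\<lambda>\<alpha>. multi_pow Theta \<alpha> (in_z b)"
  let ?k = "Const (of_nat (Poly_Mapping.lookup \<alpha> i))"
  have *: "mpderiv_xi i (?P (\<alpha> + Poly_Mapping.single j 1)) =
      ?k * ?P (\<alpha> - Poly_Mapping.single i 1 + Poly_Mapping.single j 1) + (if i = j then ?P \<alpha> else 0)"
    unfolding multi_pow_Theta_add mpderiv_xi_Theta add Theta_Const_mult ..
  \<comment> \<open>If \<open>\<alpha>\<^sub>i = 0\<close>, then the truncated \<open>\<alpha> - e\<^sub>i\<close> is multiplied by zero.\<close>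
  have "?k * ?P (\<alpha> - Poly_Mapping.single i 1 + Poly_Mapping.single j 1) =
      ?k * ?P (\<alpha> + Poly_Mapping.single j 1 - Poly_Mapping.single i 1)"
    by (cases "Poly_Mapping.lookup \<alpha> i = 0")
      (simp_all add: expo_minus_add[of \<alpha> i "Poly_Mapping.single j 1", simplified] add.commute)
  then show ?case
    unfolding * by (simp add: lookup_add lookup_single Const_add distrib_right add.commute)
qed

lemma mpderiv_xi_Theta_term:
  "mpderiv_xi i (Theta_term \<alpha> b) =
    (if Poly_Mapping.lookup \<alpha> i = 0 then 0 else Theta_term (\<alpha> - Poly_Mapping.single i 1) b)"
proof (cases "Poly_Mapping.lookup \<alpha> i = 0")
  case True
  then show ?thesis
    by (simp add: Theta_term_def mpderiv_xi_Const_mult mpderiv_xi_multi_pow_Theta)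
next
  case False
  define \<gamma> where "\<gamma> = \<alpha> - Poly_Mapping.single i 1"
  have \<alpha>: "\<alpha> = \<gamma> + Poly_Mapping.single i 1"
    using minus_single_add_single[OF False] by (simp add: \<gamma>_def)
  have "mpderiv_xi i (Theta_term \<alpha> b) =
      Const (1 / multi_fact \<alpha> * of_nat (Poly_Mapping.lookup \<alpha> i)) * multi_pow Theta \<gamma> (in_z b)"
    unfolding Theta_term_def mpderiv_xi_Const_mult mpderiv_xi_multi_pow_Theta \<gamma>_def Const_mult
    by (simp add: mult.assoc)
  also have "1 / multi_fact \<alpha> * of_nat (Poly_Mapping.lookup \<alpha> i) = 1 / multi_fact \<gamma>"
  proof -
    have "multi_fact \<alpha> = of_nat (Poly_Mapping.lookup \<alpha> i) * multi_fact \<gamma>"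
      unfolding \<alpha> multi_fact_add_single by (simp add: lookup_add)
    then show ?thesis using False by simp
  qed
  finally show ?thesis
    using False by (simp add: Theta_term_def \<gamma>_def)
qed

lemma calE_Theta_term: "calE (Theta_term \<alpha> b) = (if \<alpha> = 0 then b else 0)"
proof (cases "\<alpha> = 0")
  case True
  then show ?thesis by (simp add: Theta_term_def multi_fact_def)
next
  case False
  then obtain \<gamma> i where "\<alpha> = \<gamma> + Poly_Mapping.single i 1"
    by (rule expo_nonzeroE)
  then have "calE (Theta_term \<alpha> b) = 0"
    by (simp only: Theta_term_def calE_Const_mult multi_pow_Theta_add calE_Theta mult_zero_right)
  with False show ?thesis by simp
qed

lemma multi_pow_xi_0 [simp]: "multi_pow mpderiv_xi \<beta> 0 = 0"
  using multi_pow_xi_linear(1)[of \<beta> 0 0] by simp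

lemma calE_mpderiv_xi_Theta_term:
  "calE (multi_pow mpderiv_xi \<beta> (Theta_term \<alpha> b)) = (if \<alpha> = \<beta> then b else 0)"
proof (induction \<beta> arbitrary: \<alpha> rule: expo_induct)
  case zero
  show ?case by (simp add: calE_Theta_term)
next
  case (add \<beta> i)
  show ?case
  proof (cases "Poly_Mapping.lookup \<alpha> i = 0")
    case True
    then have "\<alpha> \<noteq> \<beta> + Poly_Mapping.single i 1"
      by (auto simp: lookup_add)
    with True show ?thesis
      unfolding multi_pow_xi_add mpderiv_xi_Theta_term by simp
  next
    case False
    then have "\<alpha> = \<beta> + Poly_Mapping.single i 1 \<longleftrightarrow> \<alpha> - Poly_Mapping.single i 1 = \<beta>"
      using minus_single_add_single[OF False] by auto
    with False show ?thesis
      unfolding multi_pow_xi_add mpderiv_xi_Theta_term by (simp add: add[simplified])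
  qed
qed

lemma calE_mpderiv_xi_sum:
  assumes "finite A"
  shows "calE (multi_pow mpderiv_xi \<beta> (\<Sum>\<alpha>\<in>A. Theta_term \<alpha> (a \<alpha>))) = (if \<beta> \<in> A then a \<beta> else 0)"
  using assms
  by (induction A) (auto simp: multi_pow_xi_linear(1) calE_add calE_mpderiv_xi_Theta_term)


section \<open>Existence of the expansion\<close>

text \<open>The sums of elements of the form \<open>\<Theta>\<^sup>\<alpha> b(z)\<close>.\<close>

inductive Theta_span :: "('n::finite + 'n) cpoly \<Rightarrow> bool" where
  Theta_span_0: "Theta_span 0"
| Theta_span_term: "Theta_span f \<Longrightarrow> Theta_span (multi_pow Theta \<alpha> (in_z b) + f)"

lemma Theta_span_add:
  assumes "Theta_span f" and g: "Theta_span g"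
  shows "Theta_span (f + g)"
  using assms(1) by induction (simp_all add: g Theta_span_term add.assoc)

lemma Theta_span_Theta:
  assumes "Theta_span f"
  shows "Theta_span (Theta i f)"
  using assms
  by induction (auto simp: Theta_add simp flip: multi_pow_Theta_add intro: Theta_span.intros)

lemma Theta_span_mpderiv_Inr:
  assumes "Theta_span f"
  shows "Theta_span (mpderiv (Inr i) f)"
  using assms
proof induction
  case (Theta_span_term f \<alpha> b)
  have "mpderiv (Inr i) (multi_pow Theta \<alpha> (in_z b)) = multi_pow Theta \<alpha> (in_z (mpderiv i b))"
    unfolding mpderiv_Inr_in_z[symmetric]
    by (rule multi_pow_commute[where D = Theta]) (rule Theta_commute mpderiv_Inr_Theta)+
  then show ?case
    by (simp add: mpderiv_add Theta_span_term.IH Theta_span.Theta_span_term)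
qed (simp add: Theta_span_0)

lemma Theta_span_xi_mult:
  assumes "Theta_span f"
  shows "Theta_span (Var (Inl i) * f)"
proof -
  have "Var (Inl i) * f = Theta i f + mpderiv (Inr i) f"
    by (simp add: Theta_def)
  with assms show ?thesis
    by (simp add: Theta_span_add Theta_span_Theta Theta_span_mpderiv_Inr)
qed

lemma Theta_span_Monom_in_z: "Theta_span (Monom (rename_expo Inl \<alpha>) * in_z b)"
proof (induction \<alpha> rule: expo_induct)
  case zero
  have "Monom (rename_expo Inl 0) * in_z b = multi_pow Theta 0 (in_z b) + 0"
    by (simp add: rename_expo_def Monom_def)
  then show ?case
    using Theta_span_term[OF Theta_span_0, of 0 b] by simp
next
  case (add \<alpha> i)
  have "Monom (rename_expo Inl (\<alpha> + Poly_Mapping.single i 1)) * in_z b =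
      Var (Inl i) * (Monom (rename_expo Inl \<alpha>) * in_z b)"
    unfolding Var_def rename_expo_add_single[OF inj_Inl] Monom_mult[symmetric] by (simp only: mult_ac)
  with Theta_span_xi_mult[OF add] show ?case by simp
qed

lemma rename_expo_map_key:
  "rename_expo Inl (Poly_Mapping.map_key Inl m) + rename_expo Inr (Poly_Mapping.map_key Inr m) = m"
proof (rule poly_mapping_eqI)
  fix v
  show "Poly_Mapping.lookup (rename_expo Inl (Poly_Mapping.map_key Inl m) +
      rename_expo Inr (Poly_Mapping.map_key Inr m)) v = Poly_Mapping.lookup m v"
    by (cases v) (simp_all add: lookup_add lookup_rename_expo_inj lookup_rename_expo_notin map_key.rep_eq)
qed

lemma Theta_span_all: "Theta_span f"
proof (induction f rule: cpoly_induct)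
  case zero
  show ?case by (rule Theta_span_0)
next
  case (add m c f)
  have "Const c * Monom m = Monom (rename_expo Inl (Poly_Mapping.map_key Inl m)) *
      in_z (Const c * Monom (Poly_Mapping.map_key Inr m))"
    unfolding in_z_Const_mult in_z_Monom mult.left_commute[of _ "Const c"] Monom_mult rename_expo_map_key ..
  with add show ?case
    by (simp add: Theta_span_add Theta_span_Monom_in_z)
qed

lemma Theta_expansion_exists:
  "\<exists>a. finite {\<alpha>. a \<alpha> \<noteq> 0} \<and> f = (\<Sum>\<alpha> | a \<alpha> \<noteq> 0. Theta_term \<alpha> (a \<alpha>))"
  using Theta_span_all[of f]
proof induction
  case Theta_span_0
  show ?case by (rule exI[of _ "\<lambda>_. 0"]) simp
next
  case (Theta_span_term f \<beta> b)
  then obtain a where fin: "finite {\<alpha>. a \<alpha> \<noteq> 0}" and f: "f = (\<Sum>\<alpha> | a \<alpha> \<noteq> 0. Theta_term \<alpha> (a \<alpha>))"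
    by blast
  define c where "c = Const (multi_fact \<beta>) * b"
  define a' where "a' = (\<lambda>\<alpha>. a \<alpha> + (if \<alpha> = \<beta> then c else 0))"
  \<comment> \<open>The sum is taken over a common superset of both supports, since \<open>a' \<beta>\<close> may vanish.\<close>
  let ?A = "insert \<beta> {\<alpha>. a \<alpha> \<noteq> 0}"
  have sub: "{\<alpha>. a' \<alpha> \<noteq> 0} \<subseteq> ?A"
    by (auto simp: a'_def)
  have "(\<Sum>\<alpha> | a' \<alpha> \<noteq> 0. Theta_term \<alpha> (a' \<alpha>)) = (\<Sum>\<alpha>\<in>?A. Theta_term \<alpha> (a' \<alpha>))"
    using fin sub by (intro sum.mono_neutral_left) auto
  also have "\<dots> = (\<Sum>\<alpha>\<in>?A. Theta_term \<alpha> (a \<alpha>)) + (\<Sum>\<alpha>\<in>?A. if \<alpha> = \<beta> then Theta_term \<beta> c else 0)"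
    unfolding sum.distrib[symmetric] by (rule sum.cong) (auto simp: a'_def Theta_term_add)
  also have "(\<Sum>\<alpha>\<in>?A. Theta_term \<alpha> (a \<alpha>)) = f"
    unfolding f using fin by (intro sum.mono_neutral_right) auto
  also have "(\<Sum>\<alpha>\<in>?A. if \<alpha> = \<beta> then Theta_term \<beta> c else 0) = multi_pow Theta \<beta> (in_z b)"
    using fin by (subst sum.delta) (auto simp: multi_pow_Theta_eq_term c_def)
  finally have "multi_pow Theta \<beta> (in_z b) + f = (\<Sum>\<alpha> | a' \<alpha> \<noteq> 0. Theta_term \<alpha> (a' \<alpha>))"
    by (simp add: add.commute)
  then show ?case
    using finite_subset[OF sub] fin by auto
qed


section \<open>The expansion theorem\<close>

theorem theorem3p2:
  fixes f :: "('n::finite + 'n) cpoly"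
  shows "(\<exists>!a :: 'n expo \<Rightarrow> 'n cpoly. finite {\<alpha>. a \<alpha> \<noteq> 0} \<and>
            f = (\<Sum>\<alpha> | a \<alpha> \<noteq> 0. Const (1 / multi_fact \<alpha>) * multi_pow Theta \<alpha> (in_z (a \<alpha>)))) \<and>
         (\<forall>a :: 'n expo \<Rightarrow> 'n cpoly. finite {\<alpha>. a \<alpha> \<noteq> 0} \<and>
            f = (\<Sum>\<alpha> | a \<alpha> \<noteq> 0. Const (1 / multi_fact \<alpha>) * multi_pow Theta \<alpha> (in_z (a \<alpha>))) \<longrightarrow>
            (\<forall>\<alpha>. a \<alpha> = calE (multi_pow mpderiv_xi \<alpha> f)) \<and> a 0 = calE f)"
proof -
  let ?expansion = "\<lambda>a. finite {\<alpha>. a \<alpha> \<noteq> 0} \<and> f = (\<Sum>\<alpha> | a \<alpha> \<noteq> 0. Theta_term \<alpha> (a \<alpha>))"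
  have coeff: "a \<alpha> = calE (multi_pow mpderiv_xi \<alpha> f)" if "?expansion a" for a \<alpha>
    using that calE_mpderiv_xi_sum[of "{\<alpha>. a \<alpha> \<noteq> 0}" \<alpha> a] by auto
  have "\<exists>!a. ?expansion a"
  proof (rule ex_ex1I)
    show "\<exists>a. ?expansion a" by (rule Theta_expansion_exists)
  next
    fix a b
    assume a: "?expansion a" and b: "?expansion b"
    show "a = b"
    proof
      fix \<alpha>
      show "a \<alpha> = b \<alpha>"
        using coeff[OF a, of \<alpha>] coeff[OF b, of \<alpha>] by (rule trans[OF _ sym])
    qed
  qed
  moreover have "(\<forall>\<alpha>. a \<alpha> = calE (multi_pow mpderiv_xi \<alpha> f)) \<and> a 0 = calE f" if "?expansion a" for a
    using coeff[OF that] coeff[OF that, of 0, unfolded multi_pow_0] by blast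
  ultimately show ?thesis
    unfolding Theta_term_def by blast
qed

end
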